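(* Let $G$ be a connected graph that is not a tree and has girth $g(G)\ge 6$. Then $\mathrm{gp}_{\mathrm d}(G)=0$ if and only if $\delta(G)\ge 2$, where $\delta(G)$ denotes the minimum degree of $G$.
   Context: All graphs are finite and simple. The girth $g(G)$ of a connected graph $G$ that is not a tree is the length of a shortest cycle of $G$. For $X\subseteq V(G)$, vertices $u,v\in V(G)$ are $X$-positionable if for every shortest $u,v$-path $P$ in $G$ we have $V(P)\cap X\subseteq\{u,v\}$. A set $X\subseteq V(G)$ is a dual general position set if every $u,v\in X$ are $X$-positionable and every $u,v\in V(G)\setminus X$ are $X$-positionable. The dual general position number $\mathrm{gp}_{\mathrm d}(G)$ is the cardinality of a largest dual general position set of $G$ (it is $0$ if only the empty set has the property). *)

theory Defs
  imports "Graph_Theory.Digraph_Component"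
begin

text \<open>
  Finite simple graphs are the symmetric digraphs of the locale \<^locale>\<open>graph\<close>: finite,
  loopfree and without parallel arcs, each edge being a pair of opposite arcs.
\<close>

text \<open>
  In a symmetric digraph \<^const>\<open>pre_digraph.cycle\<close> also accepts the closed walk of length 2
  along an edge and back, so \<^const>\<open>forest\<close> and \<^const>\<open>tree\<close> are not the undirected notions.
  Requiring length at least 3 leaves the cycles of the underlying simple graph.
\<close>

definition graph_cycle :: "('a,'b) pre_digraph \<Rightarrow> 'b awalk \<Rightarrow> bool" where
  "graph_cycle G c \<longleftrightarrow> pre_digraph.cycle G c \<and> 3 \<le> length c"

definition graph_tree :: "('a,'b) pre_digraph \<Rightarrow> bool" where
  "graph_tree G \<longleftrightarrow> connected G \<and> \<not> (\<exists>c. graph_cycle G c)"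

text \<open>Meaningful only for graphs that have a cycle.\<close>

definition girth :: "('a,'b) pre_digraph \<Rightarrow> nat" where
  "girth G = (LEAST n. \<exists>c. graph_cycle G c \<and> length c = n)"

text \<open>By symmetry and the absence of parallel arcs, the out-degree counts the neighbours.\<close>

definition min_degree :: "('a,'b) pre_digraph \<Rightarrow> nat" where
  "min_degree G = Min (out_degree G ` verts G)"

definition shortest_path :: "('a,'b) pre_digraph \<Rightarrow> 'a \<Rightarrow> 'b awalk \<Rightarrow> 'a \<Rightarrow> bool" where
  "shortest_path G u p v \<longleftrightarrow>
     pre_digraph.apath G u p v \<and> (\<forall>q. pre_digraph.apath G u q v \<longrightarrow> length p \<le> length q)"

definition positionable :: "('a,'b) pre_digraph \<Rightarrow> 'a set \<Rightarrow> 'a \<Rightarrow> 'a \<Rightarrow> bool" where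
  "positionable G X u v \<longleftrightarrow>
     (\<forall>p. shortest_path G u p v \<longrightarrow> set (pre_digraph.awalk_verts G u p) \<inter> X \<subseteq> {u, v})"

definition dual_general_position :: "('a,'b) pre_digraph \<Rightarrow> 'a set \<Rightarrow> bool" where
  "dual_general_position G X \<longleftrightarrow>
     X \<subseteq> verts G \<and>
     (\<forall>u\<in>X. \<forall>v\<in>X. positionable G X u v) \<and>
     (\<forall>u\<in>verts G - X. \<forall>v\<in>verts G - X. positionable G X u v)"

definition gp_dual :: "('a,'b) pre_digraph \<Rightarrow> nat" where
  "gp_dual G = Max (card ` {X. dual_general_position G X})"

text \<open>The maximum is taken over a finite nonempty set.\<close>

lemma dual_general_position_empty: "dual_general_position G {}"
  by (simp add: dual_general_position_def positionable_def)

lemma (in fin_digraph) finite_dual_general_position: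
  "finite {X. dual_general_position G X}"
  by (rule finite_subset[of _ "Pow (verts G)"]) (auto simp: dual_general_position_def)

end

theory Submission
  imports Defs
begin

text \<open>
  A vertex with at most one neighbour is never interior to a path, so it forms a dual general
  position set on its own. Conversely, if all degrees are at least 2, let \<open>x\<close> lie in a dual general
  position set \<open>X\<close>. Any two neighbours of \<open>x\<close> are at distance 2 with \<open>x\<close> on a shortest path, so
  exactly one of them lies in \<open>X\<close>; hence \<open>x\<close> has exactly one neighbour \<open>b\<close> outside \<open>X\<close> and one
  neighbour \<open>a\<close> in \<open>X\<close>, and likewise \<open>a\<close> has a neighbour \<open>c\<close> outside \<open>X\<close>. Without cycles of length
  below 6, the path \<open>b, x, a, c\<close> is shortest, although its ends are outside \<open>X\<close> and its interior is
  inside.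
\<close>

lemma girth_le: "graph_cycle G c \<Longrightarrow> girth G \<le> length c"
  unfolding girth_def by (rule Least_le) blast

context graph
begin

text \<open>The arc from \<open>v\<close> back to \<open>u\<close> closes the path to a cycle.
  Length at least 2 makes the closed walk have length at least 3, so it is not an edge traversed
  back and forth.\<close>

lemma girth_le_apath:
  assumes "apath u p v" "2 \<le> length p" "v \<rightarrow> u"
  shows "girth G \<le> Suc (length p)"
proof -
  obtain e where e: "e \<in> arcs G" "tail G e = v" "head G e = u"
    using assms(3) by auto
  have last: "awlast u p = v" and p: "awalk u p v"
    using assms(1) by (auto simp: apath_def)
  have walk: "awalk u (p @ [e]) u"
    using p last e by (auto simp: awalk_simps)
  \<comment> \<open>\<open>cycle\<close> requires distinctness of the vertex list without its first
    entry. In the closed walk this list is that of \<open>p\<close> with \<open>u\<close> moved from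
    the front to the end.\<close>
  have hd: "awalk_verts u p = u # tl (awalk_verts u p)"
    using p by (cases p) (auto simp: awalk_simps)
  have "tl (awalk_verts u (p @ [e])) = tl (awalk_verts u p) @ [u]"
    using last e by (simp add: awalk_verts_append[OF walk])
  moreover have "distinct (u # tl (awalk_verts u p))"
    using assms(1) hd by (simp add: apath_def)
  ultimately have "graph_cycle G (p @ [e])"
    using walk assms(2) unfolding graph_cycle_def cycle_def by auto
  from girth_le[OF this] show ?thesis by simp
qed

lemma girth_le_3:
  assumes "a \<rightarrow> b" "b \<rightarrow> c" "c \<rightarrow> a"
  shows "girth G \<le> 3"
proof -
  obtain e f where ef: "e \<in> arcs G" "tail G e = a" "head G e = b"
    "f \<in> arcs G" "tail G f = b" "head G f = c"
    using assms by (metis reachableE)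
  have "a \<noteq> b" "b \<noteq> c" "c \<noteq> a"
    using assms by (auto dest: adj_not_same)
  then have "apath a [e, f] c"
    using ef by (auto simp: apath_simps)
  from girth_le_apath[OF this _ assms(3)] show ?thesis by simp
qed

text \<open>Adjacency separates only consecutive vertices, so the two diagonals are assumed to be
  nondegenerate.\<close>

lemma girth_le_4:
  assumes "a \<rightarrow> b" "b \<rightarrow> c" "c \<rightarrow> d" "d \<rightarrow> a" "a \<noteq> c" "b \<noteq> d"
  shows "girth G \<le> 4"
proof -
  obtain e f g where ef: "e \<in> arcs G" "tail G e = a" "head G e = b"
    "f \<in> arcs G" "tail G f = b" "head G f = c" "g \<in> arcs G" "tail G g = c" "head G g = d"
    using assms(1-3) by (metis reachableE)
  have "a \<noteq> b" "b \<noteq> c" "c \<noteq> d" "d \<noteq> a"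
    using assms by (auto dest: adj_not_same)
  then have "apath a [e, f, g] d"
    using ef assms by (auto simp: apath_simps)
  from girth_le_apath[OF this _ assms(4)] show ?thesis by simp
qed

lemma girth_le_5:
  assumes "a \<rightarrow> b" "b \<rightarrow> c" "c \<rightarrow> d" "d \<rightarrow> e" "e \<rightarrow> a" "distinct [a, b, c, d, e]"
  shows "girth G \<le> 5"
proof -
  obtain p q r s where "p \<in> arcs G" "tail G p = a" "head G p = b"
    "q \<in> arcs G" "tail G q = b" "head G q = c" "r \<in> arcs G" "tail G r = c" "head G r = d"
    "s \<in> arcs G" "tail G s = d" "head G s = e"
    using assms(1-4) by (metis reachableE)
  then have "apath a [p, q, r, s] e"
    using assms(6) by (auto simp: apath_simps)
  from girth_le_apath[OF this _ assms(5)] show ?thesis by simp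
qed

text \<open>With triangles excluded, \<open>u\<close> and \<open>v\<close> are not adjacent, so the
  path through \<open>x\<close> is shortest.\<close>

lemma not_positionable_dist_2:
  assumes adj: "u \<rightarrow> x" "x \<rightarrow> v" and "u \<noteq> v" "3 < girth G" "x \<in> X"
  shows "\<not> positionable G X u v"
proof -
  obtain e f where ef: "e \<in> arcs G" "tail G e = u" "head G e = x"
    "f \<in> arcs G" "tail G f = x" "head G f = v"
    using adj by (metis reachableE)
  have neq: "u \<noteq> x" "x \<noteq> v"
    using adj by (auto dest: adj_not_same)
  have path: "apath u [e, f] v"
    using ef neq \<open>u \<noteq> v\<close> by (auto simp: apath_simps)
  have not_adj: "\<not> u \<rightarrow> v"
    using girth_le_3[of u x v] adj \<open>3 < girth G\<close> graph_symmetric[of u v] by auto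
  have "2 \<le> length q" if "apath u q v" for q
  proof (rule ccontr)
    assume "\<not> 2 \<le> length q"
    \<comment> \<open>The case rule of \<open>remdups_adj\<close> serves to split lists into length
      0, 1 and at least 2.\<close>
    then consider "q = []" | g where "q = [g]"
      by (cases q rule: remdups_adj.cases) auto
    then show False
      using that not_adj \<open>u \<noteq> v\<close>
      by cases (auto simp: apath_simps in_arcs_imp_in_arcs_ends)
  qed
  with path have "shortest_path G u [e, f] v"
    unfolding shortest_path_def by (simp add: numeral_eq_Suc)
  moreover have "x \<in> set (awalk_verts u [e, f])"
    using ef by simp
  ultimately show ?thesis
    using neq \<open>x \<in> X\<close> unfolding positionable_def by blast
qed

text \<open>Any shorter connection closes up with \<open>u, x, y, v\<close> to a short cycle:
  \<open>u = v\<close> gives a triangle, an edge gives a 4-cycle, and a common neighbour gives a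
  triangle or a 5-cycle.\<close>

lemma not_positionable_dist_3:
  assumes adj: "u \<rightarrow> x" "x \<rightarrow> y" "y \<rightarrow> v" and "u \<noteq> y" "x \<noteq> v" "5 < girth G" "x \<in> X"
  shows "\<not> positionable G X u v"
proof -
  note sym = graph_symmetric
  obtain e f g where ef: "e \<in> arcs G" "tail G e = u" "head G e = x"
    "f \<in> arcs G" "tail G f = x" "head G f = y" "g \<in> arcs G" "tail G g = y" "head G g = v"
    using adj by (metis reachableE)
  have neq: "u \<noteq> x" "x \<noteq> y" "y \<noteq> v"
    using adj by (auto dest: adj_not_same)
  have "u \<noteq> v"
    using girth_le_3[of u x y] adj \<open>5 < girth G\<close> by auto
  have path: "apath u [e, f, g] v"
    using ef neq assms \<open>u \<noteq> v\<close> by (auto simp: apath_simps)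
  have not_adj: "\<not> u \<rightarrow> v"
    using girth_le_4[of u x y v] assms sym[of u v] by auto
  have no_common: "\<not> v \<rightarrow> z" if "u \<rightarrow> z" for z
  proof
    assume "v \<rightarrow> z"
    have "z \<noteq> x"
      using girth_le_3[of x y v] adj \<open>v \<rightarrow> z\<close> \<open>5 < girth G\<close> by auto
    moreover have "z \<noteq> y"
      using girth_le_3[of u x y] adj sym[OF that] \<open>5 < girth G\<close> by auto
    moreover have "z \<noteq> u" "z \<noteq> v"
      using that \<open>v \<rightarrow> z\<close> by (auto dest: adj_not_same)
    ultimately show False
      using girth_le_5[of u x y v z] assms sym[OF that] \<open>v \<rightarrow> z\<close> neq \<open>u \<noteq> v\<close> by auto
  qed
  have "3 \<le> length q" if "apath u q v" for q
  proof (rule ccontr)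
    assume "\<not> 3 \<le> length q"
    then consider "q = []" | g where "q = [g]" | g h where "q = [g, h]"
      by (cases q rule: remdups_adj.cases) (auto simp: Suc_le_eq not_less)
    then show False
    proof cases
      case (3 g h)
      with that have "u \<rightarrow> head G g" "head G g \<rightarrow> v"
        by (auto simp: apath_simps in_arcs_imp_in_arcs_ends dest: in_arcs_imp_in_arcs_ends)
      then show False
        using no_common sym by blast
    qed (use that not_adj \<open>u \<noteq> v\<close> in \<open>auto simp: apath_simps in_arcs_imp_in_arcs_ends\<close>)
  qed
  with path have "shortest_path G u [e, f, g] v"
    unfolding shortest_path_def by (simp add: numeral_eq_Suc)
  moreover have "x \<in> set (awalk_verts u [e, f, g])"
    using ef by simp
  ultimately show ?thesis
    using neq \<open>x \<noteq> v\<close> \<open>x \<in> X\<close> unfolding positionable_def by blast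
qed

lemma adj_unique_if_out_degree_le_1:
  assumes "out_degree G v \<le> 1" "v \<rightarrow> a" "v \<rightarrow> b"
  shows "a = b"
proof -
  obtain e f where "e \<in> out_arcs G v" "head G e = a" "f \<in> out_arcs G v" "head G f = b"
    using assms by (auto elim!: reachableE)
  moreover have "e = f" if "e \<in> out_arcs G v" "f \<in> out_arcs G v" for e f
    using assms(1) that card_le_Suc0_iff_eq[of "out_arcs G v"]
    by (simp add: out_degree_def out_arcs_def)
  ultimately show ?thesis
    by blast
qed

lemma ex_two_neighbours:
  assumes "2 \<le> out_degree G v"
  obtains a b where "v \<rightarrow> a" "v \<rightarrow> b" "a \<noteq> b"
proof -
  obtain e f where ef: "e \<in> out_arcs G v" "f \<in> out_arcs G v" "e \<noteq> f"
    using assms card_le_Suc0_iff_eq[of "out_arcs G v"]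
    by (fastforce simp: out_degree_def out_arcs_def)
  then have "head G e \<noteq> head G f"
    using no_multi_arcs[of e f] by (auto simp: arc_to_ends_def)
  then show thesis
    using ef that in_arcs_imp_in_arcs_ends by (metis in_out_arcs_conv)
qed

lemma dual_general_position_singleton:
  assumes "v \<in> verts G" "out_degree G v \<le> 1"
  shows "dual_general_position G {v}"
proof -
  have "v \<notin> set (awalk_verts u p)" if p: "apath u p w" and "u \<noteq> v" "w \<noteq> v" for u p w
  proof
    assume "v \<in> set (awalk_verts u p)"
    then obtain q r where qr: "p = q @ r" "awalk u q v" "awalk v r w"
      using p by (meson awalkI_apath awalk_decomp)
    obtain q' e where q: "q = q' @ [e]"
      using qr(2) \<open>u \<noteq> v\<close> by (cases q rule: rev_cases) (auto simp: awalk_simps)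
    obtain f r' where r: "r = f # r'"
      using qr(3) \<open>w \<noteq> v\<close> by (cases r) (auto simp: awalk_simps)
    have arcs: "e \<in> arcs G" "head G e = v" "f \<in> arcs G" "tail G f = v"
      using qr by (auto simp: q r awalk_simps)
    then have "v \<rightarrow> tail G e" "v \<rightarrow> head G f"
      using graph_symmetric by (auto dest: in_arcs_imp_in_arcs_ends)
    then have "tail G e = head G f"
      using adj_unique_if_out_degree_le_1[OF assms(2)] by blast
    \<comment> \<open>Writing the vertices of \<open>p\<close> as all tails followed by the final
      head makes the vertices before and after \<open>v\<close> separate entries of a distinct
      list.\<close>
    moreover have "distinct (map (tail G) p @ [head G (last p)])"
      using p by (auto simp: apath_def awalk_verts_conv qr q)
    \<comment> \<open>The vertex after \<open>v\<close> is the tail of the next arc or, if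
      \<open>r'\<close> is empty, the end of the path.\<close>
    moreover have "head G f \<in> set (map (tail G) r' @ [head G (last r)])"
      using qr(3) by (cases r') (auto simp: r awalk_simps)
    ultimately show False
      by (auto simp: qr q r)
  qed
  then have "positionable G {v} u w" if "u \<noteq> v" "w \<noteq> v" for u w
    using that unfolding positionable_def shortest_path_def by blast
  moreover have "positionable G {v} v v"
    unfolding positionable_def by auto
  ultimately show ?thesis
    using assms(1) unfolding dual_general_position_def by auto
qed

lemma dual_general_position_imp_empty:
  assumes deg: "\<And>v. v \<in> verts G \<Longrightarrow> 2 \<le> out_degree G v" and girth: "5 < girth G"
    and X: "dual_general_position G X"
  shows "X = {}"
proof (rule ccontr)
  assume "X \<noteq> {}"
  then obtain x where x: "x \<in> X" "x \<in> verts G"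
    using X by (auto simp: dual_general_position_def)
  have pos: "positionable G X u v"
    if "u \<in> verts G" "v \<in> verts G" "u \<in> X \<longleftrightarrow> v \<in> X" for u v
    using X that by (auto simp: dual_general_position_def)
  have split: "a \<in> X \<longleftrightarrow> b \<notin> X" if "y \<in> X" "y \<rightarrow> a" "y \<rightarrow> b" "a \<noteq> b" for y a b
    using not_positionable_dist_2[of a y b X] pos[of a b] that girth graph_symmetric[of y a]
    by (auto dest: adj_in_verts)
  obtain a b where ab: "x \<rightarrow> a" "x \<rightarrow> b" "a \<in> X" "b \<notin> X"
    using ex_two_neighbours[OF deg[OF x(2)]] split[OF x(1)] by metis
  obtain c where c: "a \<rightarrow> c" "c \<noteq> x"
    using ex_two_neighbours[OF deg[of a]] ab(1) by (metis adj_in_verts(2))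
  \<comment> \<open>Since \<open>a\<close> is in \<open>X\<close>, \<open>split\<close> also applies
    at \<open>a\<close>, whose neighbour \<open>x\<close> already lies in \<open>X\<close>.\<close>
  have "c \<notin> X"
    using split[OF ab(3) c(1) graph_symmetric[OF ab(1)] c(2)] x(1) by blast
  then have "positionable G X b c"
    using pos ab c by (blast dest: adj_in_verts)
  \<comment> \<open>Together with \<open>c \<noteq> x\<close> this says that
    \<open>b, x, a, c\<close> does not backtrack.\<close>
  moreover have "b \<noteq> a" using ab by blast
  ultimately show False
    using not_positionable_dist_3[of b x a c X] ab c x(1) girth graph_symmetric by auto
qed

lemma gp_dual_eq_0_iff: "gp_dual G = 0 \<longleftrightarrow> (\<forall>X. dual_general_position G X \<longrightarrow> X = {})"
proof -
  have "gp_dual G = 0 \<longleftrightarrow> (\<forall>X. dual_general_position G X \<longrightarrow> card X = 0)"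
    unfolding gp_dual_def
    using finite_dual_general_position dual_general_position_empty[of G]
    \<comment> \<open>The empty set makes the family nonempty and also attains cardinality
      0.\<close>
    by (subst Max_eq_iff) (auto intro!: image_eqI[of _ _ "{}"])
  then show ?thesis
    by (metis card_0_eq card.empty dual_general_position_def finite_subset finite_verts)
qed

end

theorem corollary3p4:
  fixes G :: "('a, 'b) pre_digraph"
  assumes "graph G"
    and "Digraph_Component.connected G"
    and "\<not> graph_tree G"
    and "6 \<le> girth G"
  shows "gp_dual G = 0 \<longleftrightarrow> 2 \<le> min_degree G"
proof -
  interpret graph G by fact
  \<comment> \<open>\<open>Min\<close> is meaningful only on a nonempty set; connectedness supplies
    a vertex.\<close>
  have "verts G \<noteq> {}"
    using assms(2) by (simp add: connected_def strongly_connected_def)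
  then have min: "2 \<le> min_degree G \<longleftrightarrow> (\<forall>v\<in>verts G. 2 \<le> out_degree G v)"
    by (simp add: min_degree_def)
  show ?thesis
  proof
    assume gp: "gp_dual G = 0"
    have "2 \<le> out_degree G v" if "v \<in> verts G" for v
      using gp dual_general_position_singleton[OF that]
      by (fastforce simp: gp_dual_eq_0_iff)
    then show "2 \<le> min_degree G" using min by blast
  next
    assume "2 \<le> min_degree G"
    then show "gp_dual G = 0"
      using min dual_general_position_imp_empty assms(4) by (auto simp: gp_dual_eq_0_iff)
  qed
qed

end
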